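(* Let $(a_{0,m})_{m\geq 0}$ be a sequence of complex numbers, and define the infinite matrix $\mathcal{S}=(a_{n,m})_{n,m\geq 0}$ recursively by $$a_{n+1,m}=a_{n,m+1}+m\,a_{n,m}\qquad (n,m\geq 0).$$ Then for all $n,m\geq 0$, $$a_{n,m}=\sum_{k=0}^{n}\genfrac{\{}{\}}{0pt}{}{n+m}{k+m}_{m}a_{0,m+k}.$$
   Context: For an integer $r\geq 0$, the $r$-Stirling numbers of the second kind $\genfrac{\{}{\}}{0pt}{}{n}{k}_{r}$ (the number of partitions of an $n$-element set into exactly $k$ nonempty disjoint blocks such that the first $r$ elements lie in distinct blocks) are defined by: $\genfrac{\{}{\}}{0pt}{}{n}{k}_{r}=0$ for $n<r$; $\genfrac{\{}{\}}{0pt}{}{n}{k}_{r}=\delta_{k,r}$ for $n=r$; and $\genfrac{\{}{\}}{0pt}{}{n}{k}_{r}=k\genfrac{\{}{\}}{0pt}{}{n-1}{k}_{r}+\genfrac{\{}{\}}{0pt}{}{n-1}{k-1}_{r}$ for $n>r$. For $r=0$ these are the ordinary Stirling numbers of the second kind $\genfrac{\{}{\}}{0pt}{}{n}{k}$. *)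

theory Defs
  imports Complex_Main "HOL-Combinatorics.Stirling"
begin

text \<open>
  \<open>r_Stirling r n k\<close> is the \<open>r\<close>-Stirling number of the second kind with upper index \<open>n\<close>
  and lower index \<open>k\<close>. The lower index is a natural number, so for \<open>k = 0\<close> the term with
  lower index \<open>k - 1\<close>, which is negative, is 0.
\<close>

function r_Stirling :: "nat \<Rightarrow> nat \<Rightarrow> nat \<Rightarrow> nat" where
  "n < r \<Longrightarrow> r_Stirling r n k = 0"
| "n = r \<Longrightarrow> r_Stirling r n k = (if k = r then 1 else 0)"
| "n > r \<Longrightarrow> r_Stirling r n k =
     k * r_Stirling r (n - 1) k + (if k = 0 then 0 else r_Stirling r (n - 1) (k - 1))"
  by (metis linorder_neqE_nat prod_cases3) auto
termination
  by (relation "measure (\<lambda>(r, n, k). n)") auto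

lemma r_Stirling_0: "r_Stirling 0 n k = Stirling n k"
proof (induction n arbitrary: k)
  case 0
  show ?case by (cases k) auto
next
  case (Suc n)
  then show ?case by (cases k) auto
qed

end

theory Submission
  imports Defs
begin

text \<open>
  Induction on \<open>n\<close>, for all \<open>m\<close> simultaneously: the recursion defining the matrix relates row \<open>n\<close>
  at columns \<open>m\<close> and \<open>m + 1\<close>, so the induction step needs a recurrence linking the
  \<open>m\<close>-Stirling numbers to the \<open>(m + 1)\<close>-Stirling numbers. Combinatorially, a partition counted by
  \<open>r_Stirling r (n + 1) k\<close> either has the element \<open>r + 1\<close> in a block different from those of the
  first \<open>r\<close> elements, or has it in one of these \<open>r\<close> blocks.
\<close>

lemma r_Stirling_Suc:
  assumes "r \<le> n"
  shows "r_Stirling r (Suc n) k =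
    k * r_Stirling r n k + (if k = 0 then 0 else r_Stirling r n (k - 1))"
  using assms by simp

lemma r_Stirling_eq_0_if_less:
  assumes "n < k"
  shows "r_Stirling r n k = 0"
  using assms
proof (induction n arbitrary: k)
  case 0
  then show ?case by (cases "r = 0") auto
next
  case (Suc n)
  consider "Suc n < r" | "Suc n = r" | "r \<le> n" by linarith
  then show ?case
    using Suc by cases (auto simp: r_Stirling_Suc simp del: r_Stirling.simps(3))
qed

lemma r_Stirling_eq_0_if_lower_less:
  assumes "k < r"
  shows "r_Stirling r n k = 0"
  using assms
proof (induction n arbitrary: k)
  case 0
  then show ?case by auto
next
  case (Suc n)
  consider "Suc n < r" | "Suc n = r" | "r \<le> n" by linarith
  then show ?case
    using Suc by cases (auto simp: r_Stirling_Suc simp del: r_Stirling.simps(3))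
qed

text \<open>As functions of \<open>n\<close> and \<open>k\<close>, both sides obey the same
  triangular recurrence for \<open>n \<ge> r\<close>, because the factor \<open>r\<close> is
  constant; they agree at \<open>n = r\<close>.\<close>

lemma r_Stirling_Suc_left:
  assumes "r \<le> n"
  shows "r_Stirling r (Suc n) k = r * r_Stirling r n k + r_Stirling (Suc r) (Suc n) k"
  using assms
proof (induction n arbitrary: k rule: dec_induct)
  case base
  show ?case by auto
next
  case (step n)
  have "r_Stirling r (Suc (Suc n)) k =
      k * r_Stirling r (Suc n) k + (if k = 0 then 0 else r_Stirling r (Suc n) (k - 1))"
    using step.hyps by (intro r_Stirling_Suc) simp
  \<comment> \<open>The induction hypothesis enters at both \<open>k\<close> and
    \<open>k - 1\<close>; regrouping leaves one instance of the recurrence for \<open>r\<close> and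
    one for \<open>Suc r\<close>.\<close>
  also have "\<dots> = r * (k * r_Stirling r n k + (if k = 0 then 0 else r_Stirling r n (k - 1)))
      + (k * r_Stirling (Suc r) (Suc n) k
         + (if k = 0 then 0 else r_Stirling (Suc r) (Suc n) (k - 1)))"
    unfolding step.IH by (simp add: algebra_simps del: r_Stirling.simps)
  also have "\<dots> = r * r_Stirling r (Suc n) k + r_Stirling (Suc r) (Suc (Suc n)) k"
    using step.hyps by (simp only: r_Stirling_Suc Suc_le_mono)
  finally show ?case .
qed

theorem theorem1:
  fixes a :: "nat \<Rightarrow> nat \<Rightarrow> complex"
  assumes "\<And>n m. a (n + 1) m = a n (m + 1) + of_nat m * a n m"
  shows "\<forall>n m. a n m = (\<Sum>k=0..n. of_nat (r_Stirling m (n + m) (k + m)) * a 0 (m + k))"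
proof
  fix n
  show "\<forall>m. a n m = (\<Sum>k=0..n. of_nat (r_Stirling m (n + m) (k + m)) * a 0 (m + k))"
  proof (induction n)
    case 0
    show ?case by simp
  next
    case (Suc n)
    show ?case
    proof
      fix m
      let ?S = "\<lambda>r i j. of_nat (r_Stirling r i j) :: complex"
      \<comment> \<open>The extra term \<open>k = Suc n\<close> vanishes: its lower index exceeds
        \<open>n + m\<close>.\<close>
      have same: "(\<Sum>k=0..Suc n. ?S m (n + m) (k + m) * a 0 (m + k)) = a n m"
        by (simp add: Suc.IH[rule_format, of m] r_Stirling_eq_0_if_less del: r_Stirling.simps)
      \<comment> \<open>The term \<open>k = 0\<close> vanishes, as its lower index \<open>m\<close>
        is below \<open>Suc m\<close>. Shifting \<open>k\<close> then gives the induction hypothesis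
        at column \<open>Suc m\<close>.\<close>
      have "(\<Sum>k=0..Suc n. ?S (Suc m) (Suc (n + m)) (k + m) * a 0 (m + k))
          = (\<Sum>k=0..n. ?S (Suc m) (Suc (n + m)) (Suc k + m) * a 0 (m + Suc k))"
        by (simp only: sum.atLeast0_atMost_Suc_shift o_def)
           (simp add: r_Stirling_eq_0_if_lower_less del: r_Stirling.simps)
      also have "\<dots> = a n (Suc m)"
        by (simp add: Suc.IH[rule_format, of "Suc m"] del: r_Stirling.simps)
      finally have next_col:
        "(\<Sum>k=0..Suc n. ?S (Suc m) (Suc (n + m)) (k + m) * a 0 (m + k)) = a n (Suc m)" .
      \<comment> \<open>\<open>r_Stirling_Suc_left\<close> with \<open>r = m\<close> splits each
        coefficient, mirroring the two terms of the matrix recursion.\<close>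
      have "(\<Sum>k=0..Suc n. ?S m (Suc n + m) (k + m) * a 0 (m + k))
          = (\<Sum>k=0..Suc n. of_nat m * (?S m (n + m) (k + m) * a 0 (m + k))
              + ?S (Suc m) (Suc (n + m)) (k + m) * a 0 (m + k))"
        by (intro sum.cong refl)
           (simp add: r_Stirling_Suc_left algebra_simps del: r_Stirling.simps)
      also have "\<dots> = of_nat m * a n m + a n (Suc m)"
        by (simp only: sum.distrib sum_distrib_left[symmetric] same next_col)
      also have "\<dots> = a (Suc n) m"
        using assms[of n m] by simp
      finally show "a (Suc n) m = (\<Sum>k=0..Suc n. ?S m (Suc n + m) (k + m) * a 0 (m + k))" ..
    qed
  qed
qed

end
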